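(* For every integer $n\ge0$, $$\sum_{j\ge0}q^{j(j+1)}\begin{bmatrix} n\\ 2j\end{bmatrix}_{q}=\sum_{k=-\infty}^\infty\left[q^{15k^2+2k}\binom{n,\,6k;\,q}{6k}_2-q^{15k^2+22k+8}\binom{n,\,6k+4;\,q}{6k+4}_2\right].$$
   Context: $q$ is an indeterminate. $(a;q)_n=\prod_{i=0}^{n-1}(1-aq^i)$. The Gaussian polynomial is $\begin{bmatrix} A\\ B\end{bmatrix}_{q}=\frac{(q;q)_A}{(q;q)_B(q;q)_{A-B}}$ if $0\le B\le A$, and $0$ otherwise. For integers $L\ge0$, $A$, $B$, the $q$-trinomial coefficient is $$\binom{L,\,B;\,q}{A}_2=\sum_{r\ge0}\frac{q^{r(r+B)}(q;q)_L}{(q;q)_r(q;q)_{r+A}(q;q)_{L-2r-A}}=\sum_{r=0}^L q^{r(r+B)}\begin{bmatrix} L\\ r\end{bmatrix}_{q}\begin{bmatrix} L-r\\ r+A\end{bmatrix}_{q},$$ where terms with a negative subscript in the denominator are zero. All sums have only finitely many nonzero terms. *)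

theory Defs
  imports
    "HOL-Computational_Algebra.Polynomial_Factorial"
    "HOL-Library.Groups_Big_Fun"
begin

(* Z[q]'s fraction field Q(q); a field is needed for the quotients in the Gaussian
   polynomials and for the possibly negative exponents r(r+B). *)
type_synonym qfield = "int poly fract"

definition qvar :: qfield where
  "qvar = to_fract [:0, 1:]"

definition qpoch :: "'a::field \<Rightarrow> 'a \<Rightarrow> nat \<Rightarrow> 'a" where
  "qpoch a q n = (\<Prod>i<n. 1 - a * q ^ i)"

(* For q a root of unity the quotient could degenerate to division by zero;
   q = qvar is not one, see qpoch_qvar_nonzero. *)
definition gauss_poly :: "'a::field \<Rightarrow> int \<Rightarrow> int \<Rightarrow> 'a" where
  "gauss_poly q A B =
     (if 0 \<le> B \<and> B \<le> A
      then qpoch q q (nat A) / (qpoch q q (nat B) * qpoch q q (nat (A - B)))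
      else 0)"

(* qtrinomial2 q L B A is the round-bracket symbol with upper entries L, B; q,
   lower entry A and subscript 2. *)
definition qtrinomial2 :: "'a::field \<Rightarrow> nat \<Rightarrow> int \<Rightarrow> int \<Rightarrow> 'a" where
  "qtrinomial2 q L B A =
     (\<Sum>r\<le>L. q powi (int r * (int r + B)) *
        gauss_poly q (int L) (int r) * gauss_poly q (int L - int r) (int r + A))"

lemma qpoch_qvar_nonzero: "qpoch qvar qvar n \<noteq> 0"
proof -
  have "1 - qvar * qvar ^ i \<noteq> 0" for i
  proof
    assume "1 - qvar * qvar ^ i = 0"
    hence "qvar ^ Suc i = 1" by simp
    moreover have "qvar ^ m = to_fract ([:0, 1:] ^ m)" for m
      unfolding qvar_def by (induction m) (simp, simp only: power_Suc to_fract_mult)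
    ultimately have "to_fract ([:0, 1:] ^ Suc i :: int poly) = to_fract 1"
      by (metis to_fract_1)
    hence "([:0, 1:] ^ Suc i :: int poly) = 1" by (simp only: to_fract_eq_iff)
    hence "poly ([:0, 1:] ^ Suc i :: int poly) 0 = 1" by simp
    thus False by simp
  qed
  thus ?thesis by (simp add: qpoch_def)
qed

lemma qtrinomial2_eq_qpoch_sum:
  assumes "\<And>n. qpoch q q n \<noteq> 0"
  shows "qtrinomial2 q L B A =
    (\<Sum>r | 0 \<le> int r + A \<and> 0 \<le> int L - 2 * int r - A.
       q powi (int r * (int r + B)) * qpoch q q L /
       (qpoch q q r * qpoch q q (nat (int r + A)) * qpoch q q (nat (int L - 2 * int r - A))))"
proof -
  have "{r. 0 \<le> int r + A \<and> 0 \<le> int L - 2 * int r - A} \<subseteq> {..L}" by auto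
  thus ?thesis
    unfolding qtrinomial2_def
  proof (intro sum.mono_neutral_cong_right ballI)
    fix r assume "r \<in> {r. 0 \<le> int r + A \<and> 0 \<le> int L - 2 * int r - A}"
    hence r: "0 \<le> int r + A" "int r + A \<le> int L - int r" "r \<le> L" by auto
    moreover have "nat (int L - int r) = L - r"
      "int L - int r - (int r + A) = int L - 2 * int r - A" by linarith+
    ultimately show "q powi (int r * (int r + B)) *
        gauss_poly q (int L) (int r) * gauss_poly q (int L - int r) (int r + A) =
       q powi (int r * (int r + B)) * qpoch q q L /
       (qpoch q q r * qpoch q q (nat (int r + A)) * qpoch q q (nat (int L - 2 * int r - A)))"
      using assms by (simp add: gauss_poly_def algebra_simps)
  qed (auto simp: gauss_poly_def)
qed

lemma qtrinomial2_eq_0: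
  assumes "\<bar>A\<bar> > int L"
  shows "qtrinomial2 q L B A = 0"
  unfolding qtrinomial2_def using assms
  by (intro sum.neutral ballI) (auto simp: gauss_poly_def)

(* Sum_any is 0 by convention on infinite supports; the next two facts show that
   this convention is never used. *)
lemma finite_support_lhs:
  "finite {j::nat. q ^ (j * (j + 1)) * gauss_poly q (int n) (2 * int j) \<noteq> 0}"
  by (rule finite_subset[of _ "{..n}"]) (auto simp: gauss_poly_def split: if_splits)

lemma finite_support_rhs:
  "finite {k::int.
     q powi (15 * k^2 + 2 * k) * qtrinomial2 q n (6 * k) (6 * k)
     - q powi (15 * k^2 + 22 * k + 8) * qtrinomial2 q n (6 * k + 4) (6 * k + 4) \<noteq> 0}"
proof (rule finite_subset)
  show "{k::int.
     q powi (15 * k^2 + 2 * k) * qtrinomial2 q n (6 * k) (6 * k)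
     - q powi (15 * k^2 + 22 * k + 8) * qtrinomial2 q n (6 * k + 4) (6 * k + 4) \<noteq> 0}
     \<subseteq> {- int n - 4..int n + 4}"
  proof (rule subsetI, rule ccontr)
    fix k assume k: "k \<in> {k::int.
     q powi (15 * k^2 + 2 * k) * qtrinomial2 q n (6 * k) (6 * k)
     - q powi (15 * k^2 + 22 * k + 8) * qtrinomial2 q n (6 * k + 4) (6 * k + 4) \<noteq> 0}"
      and "k \<notin> {- int n - 4..int n + 4}"
    hence "\<bar>6 * k\<bar> > int n" "\<bar>6 * k + 4\<bar> > int n" by auto
    with k show False by (simp add: qtrinomial2_eq_0)
  qed
qed simp

end

theory Submission
  imports Defs
begin

text \<open>
  Write \<open>[A, B]\<close> for the Gaussian polynomials. Only trinomial coefficients with equal and even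
  parameters \<open>2 a\<close> occur, and for these the substitution \<open>j = r + a\<close> turns the defining sum into
  \<open>\<Sum>j. q^(j^2 - a^2) [n, 2 j] [2 j, j - a]\<close> (lemma \<open>qtrinomial2_even\<close>). With \<open>a = 3 k\<close> and
  \<open>a = 3 k + 2\<close> both sides of the theorem become linear combinations of the \<open>[n, 2 j]\<close>, and it
  suffices to compare coefficients, that is, to show for each \<open>j\<close> that

    \<open>S j = (\<Sum>k. q^(6 k^2 + 2 k) [2 j, j - 3 k] - q^(6 k^2 + 10 k + 4) [2 j, j - 3 k - 2])\<close>

  equals \<open>q^j\<close>; \<open>n\<close> has disappeared.

  Such an alternating sum of the rows of Pascal's triangle at distance 3 collapses because of the
  \<open>q\<close>-Pascal rule and the symmetry \<open>[N, m] = [N, N - m]\<close>: the Pascal rule splits \<open>S j\<close> into two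
  alternating sums over row \<open>2 j - 1\<close>, and the symmetry makes one of them vanish. What remains is
  \<open>q^j\<close> times the alternating sum with exponents \<open>6 k^2 - k\<close> and \<open>6 k^2 + 7 k + 2\<close>. Descending
  with this one, row by row, one of the two parts always vanishes in the same way while the other
  has the same exponents again, without any factor; so it equals its value 1 in row 0
  (lemmas \<open>flat_alternating_sum\<close> and \<open>alternating_sum\<close>).
\<close>

section \<open>Sums over functions of finite support\<close>

lemma Sum_any_sum:
  assumes "finite A" and "\<And>j. j \<in> A \<Longrightarrow> finite {k. f k j \<noteq> 0}"
  shows "Sum_any (\<lambda>k. \<Sum>j\<in>A. f k j) = (\<Sum>j\<in>A. Sum_any (\<lambda>k. f k j))"
  using assms
proof (induction A rule: finite_induct)
  case (insert x A)
  have "{k. (\<Sum>j\<in>A. f k j) \<noteq> 0} \<subseteq> (\<Union>j\<in>A. {k. f k j \<noteq> 0})"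
    by (auto elim: sum.not_neutral_contains_not_neutral)
  moreover have "finite (\<Union>j\<in>A. {k. f k j \<noteq> 0})" using insert by auto
  ultimately have "finite {k. (\<Sum>j\<in>A. f k j) \<noteq> 0}" by (rule finite_subset)
  with insert show ?case by (simp add: Sum_any.distrib)
qed simp

lemma Sum_any_diff:
  fixes f g :: "'b \<Rightarrow> 'a::ab_group_add"
  assumes "finite {k. f k \<noteq> 0}" and "finite {k. g k \<noteq> 0}"
  shows "Sum_any (\<lambda>k. f k - g k) = Sum_any f - Sum_any g"
proof -
  have "finite {k. f k - g k \<noteq> 0}"
    by (rule finite_subset[OF _ finite_UnI[OF assms]]) auto
  from Sum_any.distrib[OF this assms(2)] show ?thesis by simp
qed

section \<open>Gaussian polynomials\<close>

lemma gauss_poly_outside: "m < 0 \<or> N < m \<Longrightarrow> gauss_poly q N m = 0"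
  by (auto simp: gauss_poly_def)

lemma gauss_poly_symmetric: "gauss_poly q N m = gauss_poly q N (N - m)"
  by (simp add: gauss_poly_def mult.commute)

lemma qpoch_Suc: "qpoch a q (Suc n) = qpoch a q n * (1 - a * q ^ n)"
  by (simp add: qpoch_def)

lemma qpoch_0: "qpoch a q 0 = 1"
  by (simp add: qpoch_def)

text \<open>
  Nonvanishing of all \<open>(q; q)\<^sub>n\<close> says that \<open>q\<close> is not a root of unity, so that the quotients
  defining the Gaussian polynomials are genuine.
\<close>
locale generic_q =
  fixes q :: "'a::field"
  assumes q_nonzero: "q \<noteq> 0"
    and qpoch_nonzero: "qpoch q q n \<noteq> 0"
begin

lemma gauss_poly_0: "N \<ge> 0 \<Longrightarrow> gauss_poly q N 0 = 1"
  using qpoch_nonzero by (simp add: gauss_poly_def qpoch_0)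

lemma gauss_poly_pascal:
  "gauss_poly q (int (Suc N)) m = gauss_poly q (int N) (m - 1) + q powi m * gauss_poly q (int N) m"
proof -
  consider "m < 0 \<or> int (Suc N) < m" | "m = 0" | "m = int (Suc N)" | "1 \<le> m" "m \<le> int N"
    by linarith
  then show ?thesis
  proof cases
    case 1
    then show ?thesis by (auto simp: gauss_poly_outside)
  next
    case 2
    then show ?thesis by (simp add: gauss_poly_0 gauss_poly_outside)
  next
    case 3
    then show ?thesis
      using gauss_poly_symmetric[of q "int (Suc N)" m] gauss_poly_symmetric[of q "int N" "m - 1"]
      by (simp add: gauss_poly_0 gauss_poly_outside)
  next
    case 4
    define k l where "k = nat (m - 1)" and "l = nat (int N - m)"
    have m: "m = int (Suc k)" and N: "N = Suc (k + l)"
      using 4 by (auto simp: k_def l_def)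
    have "nat (int (Suc N) - m) = Suc l" "nat (int N - (m - 1)) = Suc l" "nat (int N - m) = l"
      "nat (m - 1) = k" "nat m = Suc k" using m N by auto
    note nats = this
    have nz: "1 - q * q ^ i \<noteq> 0" for i
      using qpoch_nonzero[of "Suc i"] by (simp add: qpoch_Suc)
    let ?x = "qpoch q q"
    have "gauss_poly q (int (Suc N)) m = ?x N * (1 - q * q ^ N) / (?x (Suc k) * ?x (Suc l))"
      using 4 nats by (simp add: gauss_poly_def qpoch_Suc del: of_nat_Suc)
    moreover have "gauss_poly q (int N) (m - 1)
        = ?x N * (1 - q * q ^ k) / (?x (Suc k) * ?x (Suc l))"
      using 4 nats nz[of k] by (simp add: gauss_poly_def qpoch_Suc)
    moreover have "gauss_poly q (int N) m = ?x N * (1 - q * q ^ l) / (?x (Suc k) * ?x (Suc l))"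
      using 4 nats nz[of l] by (simp add: gauss_poly_def qpoch_Suc)
    moreover have "q powi m = q * q ^ k" unfolding m power_int_of_nat by simp
    moreover have "1 - q * q ^ N = (1 - q * q ^ k) + (q * q ^ k) * (1 - q * q ^ l)"
      by (simp add: N algebra_simps power_add)
    ultimately show ?thesis
      by (simp add: add_divide_distrib[symmetric] distrib_left mult_ac)
  qed
qed

text \<open>The other Pascal rule is the first one for the mirror image of the row.\<close>
lemma gauss_poly_pascal':
  "gauss_poly q (int (Suc N)) m
    = gauss_poly q (int N) m + q powi (int (Suc N) - m) * gauss_poly q (int N) (m - 1)"
proof -
  have "gauss_poly q (int (Suc N)) m = gauss_poly q (int (Suc N)) (int (Suc N) - m)"
    by (rule gauss_poly_symmetric)
  also have "\<dots> = gauss_poly q (int N) (int (Suc N) - m - 1)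
      + q powi (int (Suc N) - m) * gauss_poly q (int N) (int (Suc N) - m)"
    by (rule gauss_poly_pascal)
  also have "gauss_poly q (int N) (int (Suc N) - m - 1) = gauss_poly q (int N) m"
    using gauss_poly_symmetric[of q "int N" m] by simp
  also have "gauss_poly q (int N) (int (Suc N) - m) = gauss_poly q (int N) (m - 1)"
    using gauss_poly_symmetric[of q "int N" "m - 1"] by (simp add: algebra_simps)
  finally show ?thesis .
qed

section \<open>Sums over every third entry of a row\<close>

text \<open>
  The exponents are an arbitrary function, because applying the Pascal rule to every entry then
  just changes this function.
\<close>
definition third_sum :: "(int \<Rightarrow> int) \<Rightarrow> nat \<Rightarrow> int \<Rightarrow> 'a" where
  "third_sum e N c = Sum_any (\<lambda>k. q powi e k * gauss_poly q (int N) (c - 3 * k))"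

lemma finite_support_third:
  "finite {k. f k * gauss_poly q (int N) (c - 3 * k) \<noteq> 0}"
proof (rule finite_subset)
  show "{k. f k * gauss_poly q (int N) (c - 3 * k) \<noteq> 0} \<subseteq> {- \<bar>c\<bar> - int N..\<bar>c\<bar> + int N}"
    by (auto simp: gauss_poly_def split: if_splits)
qed simp

lemma third_sum_pascal:
  "third_sum e (Suc N) c = third_sum e N (c - 1) + third_sum (\<lambda>k. e k + c - 3 * k) N c"
proof -
  have "q powi e k * gauss_poly q (int (Suc N)) (c - 3 * k) =
      q powi e k * gauss_poly q (int N) (c - 1 - 3 * k)
      + q powi (e k + c - 3 * k) * gauss_poly q (int N) (c - 3 * k)" for k
    unfolding gauss_poly_pascal
    using q_nonzero power_int_add[of q "e k" "c - 3 * k"] by (simp add: algebra_simps)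
  then show ?thesis
    unfolding third_sum_def by (simp only: Sum_any.distrib[OF finite_support_third finite_support_third])
qed

lemma third_sum_pascal':
  "third_sum e (Suc N) c
    = third_sum e N c + third_sum (\<lambda>k. e k + int (Suc N) - c + 3 * k) N (c - 1)"
proof -
  have "q powi e k * gauss_poly q (int (Suc N)) (c - 3 * k) =
      q powi e k * gauss_poly q (int N) (c - 3 * k)
      + q powi (e k + int (Suc N) - c + 3 * k) * gauss_poly q (int N) (c - 1 - 3 * k)" for k
    unfolding gauss_poly_pascal'
    using q_nonzero power_int_add[of q "e k" "int (Suc N) - (c - 3 * k)"]
    by (simp add: algebra_simps)
  then show ?thesis
    unfolding third_sum_def by (simp only: Sum_any.distrib[OF finite_support_third finite_support_third])
qed

text \<open>
  The symmetry of a row of Pascal's triangle, combined with the reflection \<open>k \<mapsto> a - k\<close> that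
  keeps the entries in their residue class modulo 3. This is the source of all cancellations.
\<close>
lemma third_sum_reflect:
  assumes "\<And>k. e' k = e (a - k)" and "c + c' = int N + 3 * a"
  shows "third_sum e N c = third_sum e' N c'"
  unfolding third_sum_def
proof (rule Sum_any.reindex_cong[where l = "\<lambda>k. a - k"])
  show "bij (\<lambda>k. a - k)" by (rule o_bij[where g = "\<lambda>k. a - k"]) auto
  have "c - 3 * (a - k) = int N - (c' - 3 * k)" for k
    using assms(2) by simp
  then have "gauss_poly q (int N) (c - 3 * (a - k)) = gauss_poly q (int N) (c' - 3 * k)" for k
    by (metis gauss_poly_symmetric)
  then show "(\<lambda>k. q powi e k * gauss_poly q (int N) (c - 3 * k)) \<circ> (\<lambda>k. a - k)
      = (\<lambda>k. q powi e' k * gauss_poly q (int N) (c' - 3 * k))"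
    by (simp add: fun_eq_iff assms(1))
qed

lemma third_sum_scale:
  assumes "\<And>k. e' k = d + e k"
  shows "third_sum e' N c = q powi d * third_sum e N c"
  unfolding third_sum_def Sum_any_right_distrib[OF finite_support_third] assms
  by (simp add: power_int_add q_nonzero mult.assoc)

lemma third_sum_row_0: "third_sum e 0 0 = q powi e 0" "third_sum e 0 (- 2) = 0"
proof -
  have "gauss_poly q 0 (- (3 * k)) = (if k = 0 then 1 else 0)" for k :: int
    by (auto simp: gauss_poly_0) (auto simp: gauss_poly_def)
  then have "q powi e k * gauss_poly q 0 (- (3 * k)) = (if k = 0 then q powi e k else 0)" for k
    by simp
  then show "third_sum e 0 0 = q powi e 0" by (simp add: third_sum_def)
  have "gauss_poly q 0 (- 2 - 3 * k) = 0" for k :: int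
    by (rule gauss_poly_outside) presburger
  then show "third_sum e 0 (- 2) = 0" by (simp add: third_sum_def)
qed

section \<open>The alternating sums\<close>

text \<open>
  The difference that stays constant when descending through the rows with central \<open>c\<close>. Its
  exponents are those of \<open>S j\<close> lowered by \<open>3 k\<close> and by \<open>3 k + 2\<close>, the offset of the entry from \<open>c\<close>;
  this is what the factor \<open>q powi m\<close> in the Pascal rule contributes.
\<close>
definition alt_sum :: "nat \<Rightarrow> int \<Rightarrow> 'a" where
  "alt_sum N c = third_sum (\<lambda>k. 6 * k^2 - k) N c - third_sum (\<lambda>k. 6 * k^2 + 7 * k + 2) N (c - 2)"

text \<open>
  In a row with odd index the two entries at \<open>int i - 3 * k\<close> and \<open>int i - 2 - 3 * (- 1 - k)\<close> are
  mirror images, and the reflection \<open>k \<mapsto> - 1 - k\<close> exchanges the two exponents.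
\<close>
lemma vanishing_pair:
  "third_sum (\<lambda>k. 6 * k^2 + 2 * k) (Suc (2 * i)) (int i)
    = third_sum (\<lambda>k. 6 * k^2 + 10 * k + 4) (Suc (2 * i)) (int i - 2)"
  by (rule third_sum_reflect[where a = "-1"]) (auto simp: power2_eq_square algebra_simps)

text \<open>
  Here the Pascal parts without a factor make up the new alternating sum; those with the factor
  \<open>q powi m\<close> are exchanged by \<open>k \<mapsto> - k\<close>.
\<close>
lemma alt_sum_odd_row: "alt_sum (Suc (2 * i)) (int i + 1) = alt_sum (2 * i) (int i)"
proof -
  have "third_sum (\<lambda>k. 6 * k^2 - k + (int i + 1) - 3 * k) (2 * i) (int i + 1)
      = third_sum (\<lambda>k. 6 * k^2 + 7 * k + 2 + (int i - 1) - 3 * k) (2 * i) (int i - 1)"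
    by (rule third_sum_reflect[where a = 0]) (auto simp: power2_eq_square algebra_simps)
  then show ?thesis unfolding alt_sum_def third_sum_pascal
    by simp
qed

text \<open>
  The mirrored Pascal rule is essential: it keeps the centre \<open>int i + 1\<close> in the parts without a
  factor and turns the exponents of the other parts into those of the vanishing pair.
\<close>
lemma alt_sum_even_row: "alt_sum (Suc (Suc (2 * i))) (int i + 1) = alt_sum (Suc (2 * i)) (int i + 1)"
proof -
  have 1: "third_sum (\<lambda>k. 6 * k^2 - k + int (Suc (Suc (2 * i))) - (int i + 1) + 3 * k)
      (Suc (2 * i)) (int i)
    = q powi (int i + 1) * third_sum (\<lambda>k. 6 * k^2 + 2 * k) (Suc (2 * i)) (int i)"
    by (rule third_sum_scale) simp
  have 2: "third_sum (\<lambda>k. 6 * k^2 + 7 * k + 2 + int (Suc (Suc (2 * i))) - (int i - 1) + 3 * k)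
      (Suc (2 * i)) (int i - 2)
    = q powi (int i + 1) * third_sum (\<lambda>k. 6 * k^2 + 10 * k + 4) (Suc (2 * i)) (int i - 2)"
    by (rule third_sum_scale) simp
  show ?thesis unfolding alt_sum_def third_sum_pascal'[of _ "Suc (2 * i)"]
    using 1 2 vanishing_pair[of i] by simp
qed

lemma flat_alternating_sum: "alt_sum (2 * i) (int i) = 1"
proof (induction i)
  case 0
  then show ?case by (simp add: alt_sum_def third_sum_row_0)
next
  case (Suc i)
  then show ?case
    using alt_sum_even_row[of i] alt_sum_odd_row[of i] by (simp add: add.commute)
qed

text \<open>
  The Pascal rule now puts the vanishing pair into the parts without a factor, and the factors
  \<open>q powi m\<close> of the remaining parts supply \<open>q ^ j\<close>.
\<close>
lemma alternating_sum:
  "third_sum (\<lambda>k. 6 * k^2 + 2 * k) (2 * j) (int j)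
    - third_sum (\<lambda>k. 6 * k^2 + 10 * k + 4) (2 * j) (int j - 2) = q ^ j"
proof (cases j)
  case 0
  then show ?thesis by (simp add: third_sum_row_0)
next
  case (Suc i)
  have 1: "third_sum (\<lambda>k. 6 * k^2 + 2 * k + (int i + 1) - 3 * k) (Suc (2 * i)) (int i + 1)
    = q powi (int i + 1) * third_sum (\<lambda>k. 6 * k^2 - k) (Suc (2 * i)) (int i + 1)"
    by (rule third_sum_scale) simp
  have 2: "third_sum (\<lambda>k. 6 * k^2 + 10 * k + 4 + (int i - 1) - 3 * k) (Suc (2 * i)) (int i - 1)
    = q powi (int i + 1) * third_sum (\<lambda>k. 6 * k^2 + 7 * k + 2) (Suc (2 * i)) (int i - 1)"
    by (rule third_sum_scale) simp
  have "third_sum (\<lambda>k. 6 * k^2 + 2 * k) (Suc (Suc (2 * i))) (int i + 1)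
      - third_sum (\<lambda>k. 6 * k^2 + 10 * k + 4) (Suc (Suc (2 * i))) (int i - 1)
    = q powi (int i + 1) * alt_sum (Suc (2 * i)) (int i + 1)"
    unfolding third_sum_pascal[of _ "Suc (2 * i)"] alt_sum_def
    using 1 2 vanishing_pair[of i] by (simp add: algebra_simps)
  also have "\<dots> = q powi int j"
    unfolding alt_sum_odd_row flat_alternating_sum using Suc by (simp add: add.commute)
  finally have "third_sum (\<lambda>k. 6 * k^2 + 2 * k) (Suc (Suc (2 * i))) (int i + 1)
      - third_sum (\<lambda>k. 6 * k^2 + 10 * k + 4) (Suc (Suc (2 * i))) (int i - 1) = q ^ j"
    by simp
  moreover have "2 * j = Suc (Suc (2 * i))" "int j = int i + 1" "int j - 2 = int i - 1"
    using Suc by auto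
  ultimately show ?thesis by (simp only:)
qed

section \<open>Trinomial coefficients\<close>

text \<open>
  Both sides are the multinomial coefficient that splits \<open>n\<close> into \<open>r\<close>, \<open>r + 2 a\<close> and the rest: one
  may choose the first part and then the second, or their union and then the first part in it.
\<close>
lemma gauss_poly_product:
  assumes "r \<ge> 0"
  shows "gauss_poly q (int n) r * gauss_poly q (int n - r) (r + 2 * a)
    = gauss_poly q (int n) (2 * (r + a)) * gauss_poly q (2 * (r + a)) r"
proof (cases "0 \<le> r + 2 * a \<and> 2 * (r + a) \<le> int n")
  case True
  have e: "2 * (r + a) - r = r + 2 * a" "int n - r - (r + 2 * a) = int n - 2 * (r + a)" by auto
  show ?thesis
    unfolding gauss_poly_def e using True assms qpoch_nonzero by simp
next
  case False
  then show ?thesis using assms by (auto simp: gauss_poly_def)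
qed

text \<open>
  With \<open>j = r + a\<close> the exponent \<open>r (r + 2 a)\<close> is a difference of squares, which separates the
  dependence on \<open>j\<close> from that on \<open>a\<close>.
\<close>
lemma qtrinomial2_even:
  "qtrinomial2 q n (2 * a) (2 * a) = (\<Sum>j\<le>n. q powi ((int j)^2 - a^2) *
     gauss_poly q (int n) (2 * int j) * gauss_poly q (int (2 * j)) (int j - a))"
  unfolding qtrinomial2_def
  \<comment> \<open>\<open>S'\<close> and \<open>T'\<close> collect the vanishing terms, whose indices may be shifted out of range.\<close>
proof (rule sum.reindex_bij_witness_not_neutral[
    where i = "\<lambda>j. nat (int j - a)" and j = "\<lambda>r. nat (int r + a)"
      and S' = "{r\<in>{..n}. \<not> (0 \<le> int r + 2 * a \<and> 2 * (int r + a) \<le> int n)}"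
      and T' = "{j\<in>{..n}. \<not> (0 \<le> int j - a \<and> int j - a \<le> 2 * int j \<and> 2 * int j \<le> int n)}"])
  fix r :: nat
  define f where "f j = q powi ((int j)^2 - a^2) *
     gauss_poly q (int n) (2 * int j) * gauss_poly q (int (2 * j)) (int j - a)" for j :: nat
  define g where "g = q powi (int r * (int r + 2 * a)) *
     gauss_poly q (int n) (int r) * gauss_poly q (int n - int r) (int r + 2 * a)"
  have "f (nat (int r + a)) = g"
  proof (cases "int r + a \<ge> 0")
    case True
    have "f (nat (int r + a)) = q powi ((int r + a)^2 - a^2) *
       (gauss_poly q (int n) (2 * (int r + a)) * gauss_poly q (2 * (int r + a)) (int r))"
      using True by (simp add: f_def)
    also have "\<dots> = g"
      unfolding gauss_poly_product[OF of_nat_0_le_iff, symmetric] g_def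
      by (simp add: power2_eq_square algebra_simps)
    finally show ?thesis .
  next
    case False
    then show ?thesis by (auto simp: f_def g_def gauss_poly_outside)
  qed
  then show "q powi ((int (nat (int r + a)))^2 - a^2) *
     gauss_poly q (int n) (2 * int (nat (int r + a))) *
     gauss_poly q (int (2 * nat (int r + a))) (int (nat (int r + a)) - a)
     = q powi (int r * (int r + 2 * a)) *
     gauss_poly q (int n) (int r) * gauss_poly q (int n - int r) (int r + 2 * a)"
    by (simp add: f_def g_def)
qed (auto simp: gauss_poly_def)

lemma trinomial_identity:
  "Sum_any (\<lambda>j::nat. q ^ (j * (j + 1)) * gauss_poly q (int n) (2 * int j)) =
    Sum_any (\<lambda>k::int.
      q powi (15 * k^2 + 2 * k) * qtrinomial2 q n (6 * k) (6 * k)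
      - q powi (15 * k^2 + 22 * k + 8) * qtrinomial2 q n (6 * k + 4) (6 * k + 4))"
proof -
  define c where "c j = q powi ((int j)^2) * gauss_poly q (int n) (2 * int j)" for j
  define u where "u k j = q powi (6 * k^2 + 2 * k) * gauss_poly q (int (2 * j)) (int j - 3 * k)"
    for k :: int and j :: nat
  define v where
    "v k j = q powi (6 * k^2 + 10 * k + 4) * gauss_poly q (int (2 * j)) (int j - 2 - 3 * k)"
    for k :: int and j :: nat
  have u: "q powi (15 * k^2 + 2 * k) * qtrinomial2 q n (6 * k) (6 * k) = (\<Sum>j\<le>n. c j * u k j)" for k
  proof -
    have e: "q powi (15 * k^2 + 2 * k) * q powi ((int j)^2 - (3 * k)^2)
        = q powi ((int j)^2) * q powi (6 * k^2 + 2 * k)" for j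
      using q_nonzero by (simp add: power_int_add[symmetric] power2_eq_square algebra_simps)
    have "q powi (15 * k^2 + 2 * k) * qtrinomial2 q n (6 * k) (6 * k)
        = (\<Sum>j\<le>n. (q powi (15 * k^2 + 2 * k) * q powi ((int j)^2 - (3 * k)^2)) *
          (gauss_poly q (int n) (2 * int j) * gauss_poly q (int (2 * j)) (int j - 3 * k)))"
      using qtrinomial2_even[of n "3 * k"] by (simp add: sum_distrib_left mult.assoc)
    also have "\<dots> = (\<Sum>j\<le>n. c j * u k j)"
      unfolding e c_def u_def by (simp only: mult_ac)
    finally show ?thesis .
  qed
  have v: "q powi (15 * k^2 + 22 * k + 8) * qtrinomial2 q n (6 * k + 4) (6 * k + 4)
      = (\<Sum>j\<le>n. c j * v k j)" for k
  proof -
    have e: "q powi (15 * k^2 + 22 * k + 8) * q powi ((int j)^2 - (3 * k + 2)^2)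
        = q powi ((int j)^2) * q powi (6 * k^2 + 10 * k + 4)" for j
      using q_nonzero by (simp add: power_int_add[symmetric] power2_eq_square algebra_simps)
    have even: "2 * (3 * k + 2) = 6 * k + 4" and shift: "int j - (3 * k + 2) = int j - 2 - 3 * k"
      for j by simp_all
    have "q powi (15 * k^2 + 22 * k + 8) * qtrinomial2 q n (6 * k + 4) (6 * k + 4)
        = (\<Sum>j\<le>n. (q powi (15 * k^2 + 22 * k + 8) * q powi ((int j)^2 - (3 * k + 2)^2)) *
          (gauss_poly q (int n) (2 * int j) * gauss_poly q (int (2 * j)) (int j - 2 - 3 * k)))"
      using qtrinomial2_even[of n "3 * k + 2"]
      unfolding even shift by (simp add: sum_distrib_left mult.assoc)
    also have "\<dots> = (\<Sum>j\<le>n. c j * v k j)"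
      unfolding e c_def v_def by (simp only: mult_ac)
    finally show ?thesis .
  qed
  have fu: "finite {k. u k j \<noteq> 0}" and fv: "finite {k. v k j \<noteq> 0}" for j
    unfolding u_def v_def by (rule finite_support_third)+
  have fuv: "finite {k. u k j - v k j \<noteq> 0}" for j
    by (rule finite_subset[OF _ finite_UnI[OF fu[of j] fv[of j]]]) auto
  have "Sum_any (\<lambda>k. (\<Sum>j\<le>n. c j * u k j) - (\<Sum>j\<le>n. c j * v k j))
      = Sum_any (\<lambda>k. \<Sum>j\<le>n. c j * (u k j - v k j))"
    by (simp add: sum_subtractf right_diff_distrib)
  also have "\<dots> = (\<Sum>j\<le>n. Sum_any (\<lambda>k. c j * (u k j - v k j)))"
    by (rule Sum_any_sum) (auto intro: finite_subset[OF _ fuv])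
  also have "\<dots> = (\<Sum>j\<le>n. c j * (Sum_any (\<lambda>k. u k j) - Sum_any (\<lambda>k. v k j)))"
    by (simp add: Sum_any_right_distrib[OF fuv, symmetric] Sum_any_diff[OF fu fv])
  also have "\<dots> = (\<Sum>j\<le>n. c j * q ^ j)"
    using alternating_sum by (simp add: u_def v_def third_sum_def)
  also have "\<dots> = (\<Sum>j\<le>n. q ^ (j * (j + 1)) * gauss_poly q (int n) (2 * int j))"
  proof -
    have "c j * q ^ j = q ^ (j * (j + 1)) * gauss_poly q (int n) (2 * int j)" for j
    proof -
      have "q powi ((int j)^2) = q ^ (j^2)" by (metis power_int_of_nat of_nat_power)
      then show ?thesis by (simp add: c_def power_add power2_eq_square)
    qed
    then show ?thesis by (simp only:)
  qed
  also have "\<dots> = Sum_any (\<lambda>j::nat. q ^ (j * (j + 1)) * gauss_poly q (int n) (2 * int j))"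
    by (rule Sum_any.expand_superset[symmetric]) (auto simp: gauss_poly_def split: if_splits)
  finally show ?thesis unfolding u v by simp
qed

end

theorem mainTheorem20:
  fixes n :: nat
  shows "Sum_any (\<lambda>j::nat. qvar ^ (j * (j + 1)) * gauss_poly qvar (int n) (2 * int j)) =
    Sum_any (\<lambda>k::int.
      qvar powi (15 * k^2 + 2 * k) * qtrinomial2 qvar n (6 * k) (6 * k)
      - qvar powi (15 * k^2 + 22 * k + 8) * qtrinomial2 qvar n (6 * k + 4) (6 * k + 4))"
proof -
  have "qvar \<noteq> 0" by (simp add: qvar_def)
  then interpret generic_q qvar
    by unfold_locales (simp_all add: qpoch_qvar_nonzero)
  show ?thesis by (rule trinomial_identity)
qed

end
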